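(* As relations on $\mathcal W$, $$\Delta_{\mathcal W}\subsetneq\ \sim_{\rho}\ \subsetneq\ \sim_{a}.$$
   Context: $Q_3$ is the $1$-skeleton (graph) of the three-dimensional cube, with vertex set $V=\{0,1\}^3$ and coordinates numbered $0,1,2$; two vertices are adjacent iff they differ in exactly one coordinate. A vertex is written $b_2b_1b_0$ ($b_i$ the $i$-th coordinate) and identified with the integer $4b_2+2b_1+b_0\in\{0,\ldots,7\}$. The basepoint is $o=000$. A walk is $w=(o;a_1a_2\cdots a_n)$ with $n\ge0$, $a_k\in\{0,1,2\}$; its vertex sequence is $v_0=o,v_1,\ldots,v_n$, where $v_k$ is obtained from $v_{k-1}$ by flipping coordinate $a_k$. It is closed if $v_n=o$. $\mathcal W$ is the monoid of based closed walks under concatenation of step sequences, with identity the empty walk; two walks are equal iff their step sequences coincide. Reduced loop word: fix the spanning tree of $Q_3$ given by the path $000,001,011,010,110,111,101,100$ (i.e. $0,1,3,2,6,7,5,4$). The five remaining (cotree) edges $(0,2),(0,4),(1,5),(3,7),(4,6)$ are oriented from the smaller to the larger integer and denoted $x_1,\ldots,x_5$ in this order; $F_5$ is the free group on $x_1,\ldots,x_5$. For $w\in\mathcal W$, reading the steps in order, a forward crossing of the $i$-th cotree edge contributes $x_i$, a backward crossing contributes $x_i^{-1}$, and a tree edge contributes nothing; $\rho(w)\in F_5$ is the free reduction of the resulting word. The map $\rho:\mathcal W\to F_5$ is a monoid homomorphism. Put $a=\mathrm{ab}\circ\rho:\mathcal W\to\mathbb Z^5$, where $\mathrm{ab}:F_5\to\mathbb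 Z^5$ is abelianization (exponent sums). For a homomorphism $r$ on $\mathcal W$, $\sim_r$ is the kernel congruence: $x\sim_r y\iff r(x)=r(y)$. $\Delta_{\mathcal W}$ is equality on $\mathcal W$. Relations are compared as subsets of $\mathcal W\times\mathcal W$. *)

theory Defs
  imports "HOL-Algebra.Group"
begin

section \<open>Free groups as reduced words\<close>

text \<open>
  A letter \<open>(g, True)\<close> stands for the generator \<open>g\<close>, and \<open>(g, False)\<close> for its inverse.
\<close>

type_synonym 'g letter = "'g \<times> bool"

fun inv_letter :: "'g letter \<Rightarrow> 'g letter" where
  "inv_letter (g, e) = (g, \<not> e)"

inductive cancel_step :: "'g letter list \<Rightarrow> 'g letter list \<Rightarrow> bool" where
  "cancel_step (u @ x # inv_letter x # v) (u @ v)"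

definition reduced :: "'g letter list \<Rightarrow> bool" where
  "reduced w \<longleftrightarrow> (\<nexists>w'. cancel_step w w')"

fun cancel_cons :: "'g letter \<Rightarrow> 'g letter list \<Rightarrow> 'g letter list" where
  "cancel_cons x [] = [x]"
| "cancel_cons x (y # ys) = (if y = inv_letter x then ys else x # y # ys)"

definition free_reduce :: "'g letter list \<Rightarrow> 'g letter list" where
  "free_reduce w = foldr cancel_cons w []"

definition free_group :: "'g letter list monoid" where
  "free_group = \<lparr>carrier = {w. reduced w}, mult = (\<lambda>u v. free_reduce (u @ v)), one = []\<rparr>"

lemma inv_letter_inv_letter [simp]: "inv_letter (inv_letter x) = x"
  by (cases x) auto

lemma inv_letter_neq [simp]: "inv_letter x \<noteq> x" "x \<noteq> inv_letter x"
  by (cases x; auto)+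

lemma reduced_Nil [simp]: "reduced []"
  by (auto simp: reduced_def elim: cancel_step.cases)

lemma reduced_Cons:
  "reduced (x # w) \<longleftrightarrow> reduced w \<and> (w = [] \<or> hd w \<noteq> inv_letter x)"
proof
  assume r: "reduced (x # w)"
  have "reduced w"
    unfolding reduced_def
  proof
    assume "\<exists>w'. cancel_step w w'"
    then obtain u y v where "w = u @ y # inv_letter y # v"
      by (auto elim: cancel_step.cases)
    then have "cancel_step (x # w) ((x # u) @ v)"
      using cancel_step.intros[of "x # u" y v] by simp
    with r show False by (auto simp: reduced_def)
  qed
  moreover have "w = [] \<or> hd w \<noteq> inv_letter x"
  proof (rule ccontr)
    assume "\<not> (w = [] \<or> hd w \<noteq> inv_letter x)"
    then obtain v where "w = inv_letter x # v" by (cases w) auto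
    then have "cancel_step (x # w) v" using cancel_step.intros[of "[]" x v] by simp
    with r show False by (auto simp: reduced_def)
  qed
  ultimately show "reduced w \<and> (w = [] \<or> hd w \<noteq> inv_letter x)" ..
next
  assume r: "reduced w \<and> (w = [] \<or> hd w \<noteq> inv_letter x)"
  show "reduced (x # w)"
    unfolding reduced_def
  proof
    assume "\<exists>w'. cancel_step (x # w) w'"
    then obtain u y v where e: "x # w = u @ y # inv_letter y # v"
      by (auto elim: cancel_step.cases)
    show False
    proof (cases u)
      case Nil
      with e r show False by auto
    next
      case (Cons z u')
      with e have "cancel_step w (u' @ v)" by (auto intro: cancel_step.intros)
      with r show False by (auto simp: reduced_def)
    qed
  qed
qed

lemma reduced_cancel_cons: "reduced w \<Longrightarrow> reduced (cancel_cons x w)"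
  by (cases w) (auto simp: reduced_Cons)

lemma cancel_cons_inverse:
  "reduced w \<Longrightarrow> cancel_cons x (cancel_cons (inv_letter x) w) = w"
  by (cases w rule: remdups_adj.cases) (auto simp: reduced_Cons)

lemma reduced_foldr: "reduced v \<Longrightarrow> reduced (foldr cancel_cons u v)"
  by (induction u) (auto intro: reduced_cancel_cons)

lemma reduced_free_reduce: "reduced (free_reduce w)"
  by (simp add: free_reduce_def reduced_foldr)

lemma cancel_steps_Cons: "cancel_step\<^sup>*\<^sup>* u v \<Longrightarrow> cancel_step\<^sup>*\<^sup>* (x # u) (x # v)"
proof (induction rule: rtranclp_induct)
  case (step y z)
  then obtain a c b where "y = a @ c # inv_letter c # b" "z = a @ b"
    by (auto elim: cancel_step.cases)
  then have "cancel_step (x # y) (x # z)"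
    using cancel_step.intros[of "x # a" c b] by simp
  with step.IH show ?case by (rule rtranclp.rtrancl_into_rtrancl)
qed simp

lemma cancel_steps_cancel_cons: "cancel_step\<^sup>*\<^sup>* (x # w) (cancel_cons x w)"
  using cancel_step.intros[of "[]" x] by (cases w) auto

lemma free_reduce_steps: "cancel_step\<^sup>*\<^sup>* w (free_reduce w)"
proof (induction w)
  case (Cons x w)
  then show ?case
    using rtranclp_trans[OF cancel_steps_Cons[OF Cons.IH] cancel_steps_cancel_cons]
    by (simp add: free_reduce_def)
qed (simp add: free_reduce_def)

lemma free_reduce_append: "free_reduce (u @ v) = foldr cancel_cons u (free_reduce v)"
  by (simp add: free_reduce_def)

lemma free_reduce_step: "cancel_step u v \<Longrightarrow> free_reduce u = free_reduce v"
  by (erule cancel_step.cases)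
    (simp add: free_reduce_def cancel_cons_inverse reduced_foldr)

lemma free_reduce_eq: "cancel_step\<^sup>*\<^sup>* u v \<Longrightarrow> free_reduce u = free_reduce v"
  by (induction rule: rtranclp_induct) (auto dest: free_reduce_step)

lemma free_reduce_reduced: "reduced w \<Longrightarrow> free_reduce w = w"
  using free_reduce_steps[of w] by (auto simp: reduced_def elim: converse_rtranclpE)

theorem free_reduce_unique:
  "cancel_step\<^sup>*\<^sup>* w v \<and> reduced v \<longleftrightarrow> v = free_reduce w"
  by (metis free_reduce_eq free_reduce_reduced free_reduce_steps reduced_free_reduce)

lemma cancel_step_append:
  assumes "cancel_step u u'"
  shows "cancel_step (u @ v) (u' @ v)"
  using assms
proof cases
  case (1 a x b)
  then show ?thesis using cancel_step.intros[of a x "b @ v"] by simp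
qed

lemma free_reduce_append_left: "free_reduce (free_reduce u @ v) = free_reduce (u @ v)"
proof -
  have "cancel_step\<^sup>*\<^sup>* (u @ v) (free_reduce u @ v)"
    using free_reduce_steps[of u]
    by (induction rule: rtranclp_induct)
      (auto intro: rtranclp.rtrancl_into_rtrancl cancel_step_append)
  then show ?thesis using free_reduce_eq by metis
qed

lemma free_reduce_append_right: "free_reduce (u @ free_reduce v) = free_reduce (u @ v)"
  by (simp add: free_reduce_append free_reduce_reduced reduced_free_reduce)

lemma free_reduce_inverse: "free_reduce (rev (map inv_letter w) @ w) = []"
proof (induction w)
  case (Cons x w)
  have "cancel_step (rev (map inv_letter (x # w)) @ x # w) (rev (map inv_letter w) @ w)"
    using cancel_step.intros[of "rev (map inv_letter w)" "inv_letter x" w] by simp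
  with Cons show ?case using free_reduce_step by metis
qed (simp add: free_reduce_def)

lemma group_free_group: "group (free_group :: 'g letter list monoid)"
proof (rule groupI)
  fix x :: "'g letter list"
  assume "x \<in> carrier free_group"
  show "\<exists>y\<in>carrier free_group. y \<otimes>\<^bsub>free_group\<^esub> x = \<one>\<^bsub>free_group\<^esub>"
    by (rule bexI[of _ "free_reduce (rev (map inv_letter x))"])
      (simp_all add: free_group_def free_reduce_append_left free_reduce_inverse
        reduced_free_reduce)
qed (simp_all add: free_group_def reduced_free_reduce free_reduce_reduced
      free_reduce_append_left free_reduce_append_right)

text \<open>Abelianization, with the free abelian group on \<open>'g\<close> (for finite \<open>'g\<close>) written as \<open>'g \<Rightarrow> int\<close>.\<close>

definition exponent_sum :: "'g letter list \<Rightarrow> 'g \<Rightarrow> int" where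
  "exponent_sum w g = (\<Sum>(h, e)\<leftarrow>w. if h = g then (if e then 1 else -1) else 0)"

definition integer_vectors :: "('g \<Rightarrow> int) monoid" where
  "integer_vectors = \<lparr>carrier = UNIV, mult = (\<lambda>p q g. p g + q g), one = (\<lambda>g. 0)\<rparr>"

lemma exponent_sum_append:
  "exponent_sum (u @ v) g = exponent_sum u g + exponent_sum v g"
  by (simp add: exponent_sum_def)

lemma exponent_sum_step: "cancel_step u v \<Longrightarrow> exponent_sum u = exponent_sum v"
proof (erule cancel_step.cases)
  fix a x b
  assume "u = a @ x # inv_letter x # b" "v = a @ b"
  then show "exponent_sum u = exponent_sum v"
    by (cases x) (auto simp: exponent_sum_def)
qed

lemma exponent_sum_free_reduce: "exponent_sum (free_reduce w) = exponent_sum w"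
  using free_reduce_steps[of w]
  by (induction rule: rtranclp_induct) (auto dest: exponent_sum_step)

lemma exponent_sum_hom: "exponent_sum \<in> hom free_group integer_vectors"
  by (auto simp: hom_def free_group_def integer_vectors_def exponent_sum_free_reduce
      exponent_sum_append)

section \<open>Closed walks in the cube graph\<close>

text \<open>
  The vertex \<open>b\<^sub>2b\<^sub>1b\<^sub>0\<close> is represented by the natural number \<open>4b\<^sub>2 + 2b\<^sub>1 + b\<^sub>0\<close>, so that
  its \<open>i\<close>-th coordinate is \<open>bit v i\<close> and flipping that coordinate is \<open>flip_bit i v\<close>.
  A walk is given by its step sequence; it always starts at the vertex \<open>0\<close>.
\<close>

definition cube_vertices :: "nat set" where
  "cube_vertices = {0..<8}"

definition cube_edges :: "nat set set" where
  "cube_edges = {{u, v} |u v. u \<in> cube_vertices \<and> v \<in> cube_vertices \<and>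
     (\<exists>!i. i \<in> {0, 1, 2} \<and> bit u i \<noteq> bit v i)}"

definition endpoint :: "nat \<Rightarrow> nat list \<Rightarrow> nat" where
  "endpoint v s = fold flip_bit s v"

definition closed_walks :: "nat list set" where
  "closed_walks = {s. set s \<subseteq> {0, 1, 2} \<and> endpoint 0 s = 0}"

definition walk_monoid :: "nat list monoid" where
  "walk_monoid = \<lparr>carrier = closed_walks, mult = (@), one = []\<rparr>"

lemma flip_bit_cube:
  "v \<in> cube_vertices \<Longrightarrow> i \<in> {0, 1, 2} \<Longrightarrow> flip_bit i v \<in> cube_vertices"
  "v \<in> cube_vertices \<Longrightarrow> i \<in> {0, 1, 2} \<Longrightarrow> {v, flip_bit i v} \<in> cube_edges"
proof -
  show *: "flip_bit i v \<in> cube_vertices" if "v \<in> cube_vertices" "i \<in> {0, 1, 2}" for i v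
  proof -
    have "\<forall>v\<in>set [0..<8]. \<forall>i\<in>set [0, 1, 2]. flip_bit i v < (8::nat)"
      by code_simp
    with that show ?thesis by (auto simp: cube_vertices_def)
  qed
  show "{v, flip_bit i v} \<in> cube_edges" if "v \<in> cube_vertices" "i \<in> {0, 1, 2}"
    unfolding cube_edges_def
    using that *[OF that] by (intro CollectI exI[of _ v] exI[of _ "flip_bit i v"])
      (auto simp: bit_flip_bit_iff)
qed

lemma endpoint_append: "endpoint v (s @ t) = endpoint (endpoint v s) t"
  by (simp add: endpoint_def)

lemma monoid_walk_monoid: "monoid walk_monoid"
  by (rule monoidI) (auto simp: walk_monoid_def closed_walks_def endpoint_append, simp add: endpoint_def)

definition tree_path :: "nat list" where
  "tree_path = [0, 1, 3, 2, 6, 7, 5, 4]"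

definition tree_edges :: "nat set set" where
  "tree_edges = {{tree_path ! k, tree_path ! Suc k} |k. k < 7}"

text \<open>
  The cotree edges, each paired with its generator and oriented from the smaller to the
  larger endpoint.
\<close>

datatype gen = X1 | X2 | X3 | X4 | X5

definition cotree :: "((nat \<times> nat) \<times> gen) list" where
  "cotree = [((0, 2), X1), ((0, 4), X2), ((1, 5), X3), ((3, 7), X4), ((4, 6), X5)]"

lemma ex1_coordinate:
  fixes P :: "nat \<Rightarrow> bool"
  shows "(\<exists>!i. i \<in> {0, 1, 2} \<and> P i) \<longleftrightarrow>
    (P 0 \<and> \<not> P 1 \<and> \<not> P 2) \<or> (\<not> P 0 \<and> P 1 \<and> \<not> P 2) \<or> (\<not> P 0 \<and> \<not> P 1 \<and> P 2)"
proof -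
  have "(\<exists>!i. i \<in> A \<and> P i) \<longleftrightarrow> (\<exists>i\<in>A. P i \<and> (\<forall>j\<in>A. P j \<longrightarrow> j = i))" for A
    by blast
  then show ?thesis by (simp only: ball_simps bex_simps) auto
qed

lemma cotree_edges: "(\<lambda>((u, v), g). {u, v}) ` set cotree = cube_edges - tree_edges"
proof -
  let ?adj = "\<lambda>u v. (bit u 0 \<noteq> bit v 0 \<and> bit u 1 = bit v 1 \<and> bit u 2 = bit v 2) \<or>
    (bit u 0 = bit v 0 \<and> bit u 1 \<noteq> bit v 1 \<and> bit u 2 = bit v 2) \<or>
    (bit u 0 = bit v 0 \<and> bit u 1 = bit v 1 \<and> bit u 2 \<noteq> bit v (2::nat))"
  have *: "{{u, v} |u v. u \<in> {0..<8} \<and> v \<in> {0..<8} \<and> P u v} =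
      (\<lambda>(u, v). {u, v}) ` set (filter (\<lambda>(u, v). P u v) (List.product [0..<8] [0..<8]))"
    for P :: "nat \<Rightarrow> nat \<Rightarrow> bool"
    unfolding set_filter set_product set_upt by (auto, blast)
  have adj: "(\<exists>!i. i \<in> {0, 1, 2} \<and> bit u i \<noteq> bit v i) \<longleftrightarrow> ?adj u v" for u v :: nat
    unfolding ex1_coordinate by argo
  have "cube_edges = (\<lambda>(u, v). {u, v}) ` set (filter (\<lambda>(u, v). ?adj u v)
      (List.product [0..<8] [0..<8]))"
    unfolding cube_edges_def cube_vertices_def adj by (rule *)
  also have "filter (\<lambda>(u, v). ?adj u v) (List.product [0..<8] [0..<8]) =
      [(0, 1), (0, 2), (0, 4), (1, 0), (1, 3), (1, 5), (2, 0), (2, 3), (2, 6), (3, 1), (3, 2),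
       (3, 7), (4, 0), (4, 5), (4, 6), (5, 1), (5, 4), (5, 7), (6, 2), (6, 4), (6, 7), (7, 3),
       (7, 5), (7, 6)]"
    by code_simp
  finally have ce: "cube_edges = {{0, 1}, {0, 2}, {0, 4}, {1, 3}, {1, 5}, {2, 3}, {2, 6},
      {3, 7}, {4, 5}, {4, 6}, {5, 7}, {6, 7}}"
    by (simp add: insert_commute)
  have "tree_edges = (\<lambda>k. {tree_path ! k, tree_path ! Suc k}) ` {..<7}"
    unfolding tree_edges_def by blast
  also have "{..<7} = {0, 1, 2, 3, 4, 5, 6::nat}"
    by (simp add: lessThan_nat_numeral lessThan_Suc insert_commute)
  finally have te: "tree_edges = {{0, 1}, {1, 3}, {3, 2}, {2, 6}, {6, 7}, {7, 5}, {5, 4}}"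
    by (simp add: tree_path_def)
  show ?thesis unfolding ce te
    by (simp add: cotree_def insert_Diff_if doubleton_eq_iff)
qed

definition crossing :: "nat \<Rightarrow> nat \<Rightarrow> gen letter list" where
  "crossing u v =
    (case map_of cotree (u, v) of
       Some g \<Rightarrow> [(g, True)]
     | None \<Rightarrow> (case map_of cotree (v, u) of Some g \<Rightarrow> [(g, False)] | None \<Rightarrow> []))"

primrec crossing_word :: "nat \<Rightarrow> nat list \<Rightarrow> gen letter list" where
  "crossing_word v [] = []"
| "crossing_word v (i # s) = crossing v (flip_bit i v) @ crossing_word (flip_bit i v) s"

text \<open>
  \<open>loop_word\<close> is the map \<open>\<rho>\<close> into the free group on the five generators (see
  \<open>loop_word_hom\<close>), and \<open>loop_class\<close> is the map \<open>a\<close> into the integer vectors indexed by them.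
\<close>

definition loop_word :: "nat list \<Rightarrow> gen letter list" where
  "loop_word s = free_reduce (crossing_word 0 s)"

definition loop_class :: "nat list \<Rightarrow> gen \<Rightarrow> int" where
  "loop_class = exponent_sum \<circ> loop_word"

lemma crossing_word_append:
  "crossing_word v (s @ t) = crossing_word v s @ crossing_word (endpoint v s) t"
  by (induction s arbitrary: v) (simp_all add: endpoint_def)

lemma loop_word_hom: "loop_word \<in> hom walk_monoid free_group"
  by (auto simp: hom_def walk_monoid_def free_group_def loop_word_def reduced_free_reduce
      closed_walks_def crossing_word_append free_reduce_append_left free_reduce_append_right)

lemma loop_class_hom: "loop_class \<in> hom walk_monoid integer_vectors"
  unfolding loop_class_def by (rule hom_compose[OF loop_word_hom exponent_sum_hom])

definition kernel_congruence :: "(nat list \<Rightarrow> 'b) \<Rightarrow> (nat list \<times> nat list) set" where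
  "kernel_congruence r = {(x, y). x \<in> closed_walks \<and> y \<in> closed_walks \<and> r x = r y}"

end

theory Submission imports Defs begin

text \<open>
  Both inclusions are immediate, the second because the class is a function of the loop word.
  The first is strict because \<open>[0, 0]\<close>, which runs along a tree edge and back, has the loop word
  of the empty walk. For the second, take two faces of the cube through the basepoint whose
  loop words do not commute in the free group: concatenating their boundary walks in the two
  possible orders gives distinct loop words with the same exponent sums.
\<close>

lemma kernel_congruence_comp: "kernel_congruence r \<subseteq> kernel_congruence (f \<circ> r)"
  by (auto simp: kernel_congruence_def)

lemma Id_on_subset_kernel_congruence: "Id_on closed_walks \<subseteq> kernel_congruence r"
  by (auto simp: kernel_congruence_def)

lemma loop_class_append_commute:
  assumes "s \<in> closed_walks" "t \<in> closed_walks"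
  shows "loop_class (s @ t) = loop_class (t @ s)"
  using hom_mult[OF loop_class_hom, of s t] hom_mult[OF loop_class_hom, of t s] assms
  by (simp add: walk_monoid_def integer_vectors_def add.commute)

lemma closed_walks_append:
  "s \<in> closed_walks \<Longrightarrow> t \<in> closed_walks \<Longrightarrow> s @ t \<in> closed_walks"
  by (auto simp: closed_walks_def endpoint_append)

theorem theorem6p1:
  "Id_on closed_walks \<subset> kernel_congruence loop_word \<and>
   kernel_congruence loop_word \<subset> kernel_congruence loop_class"
proof
  have "[] \<in> closed_walks" "[0, 0] \<in> closed_walks"
    unfolding closed_walks_def mem_Collect_eq by code_simp+
  moreover have "loop_word [] = loop_word [0, 0]"
    by code_simp
  ultimately have "([], [0, 0]) \<in> kernel_congruence loop_word"
    by (simp add: kernel_congruence_def)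
  moreover have "([], [0, 0]) \<notin> Id_on closed_walks"
    by auto
  ultimately show "Id_on closed_walks \<subset> kernel_congruence loop_word"
    using Id_on_subset_kernel_congruence by blast
next
  \<comment> \<open>The boundaries of the faces \<open>0, 1, 3, 2\<close> and \<open>0, 1, 5, 4\<close>, with loop words
    \<open>x\<^sub>1\<^sup>-\<^sup>1\<close> and \<open>x\<^sub>3 x\<^sub>2\<^sup>-\<^sup>1\<close>.\<close>
  let ?p = "[0, 1, 0, 1]" and ?q = "[0, 2, 0, 2]"
  have closed: "?p \<in> closed_walks" "?q \<in> closed_walks"
    unfolding closed_walks_def mem_Collect_eq by code_simp+
  have "(?p @ ?q, ?q @ ?p) \<in> kernel_congruence loop_class"
    using closed_walks_append[OF closed] closed_walks_append[OF closed(2,1)]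
      loop_class_append_commute[OF closed]
    by (simp add: kernel_congruence_def)
  moreover have "loop_word (?p @ ?q) \<noteq> loop_word (?q @ ?p)"
    by code_simp
  then have "(?p @ ?q, ?q @ ?p) \<notin> kernel_congruence loop_word"
    by (simp add: kernel_congruence_def)
  moreover have "kernel_congruence loop_word \<subseteq> kernel_congruence loop_class"
    unfolding loop_class_def by (rule kernel_congruence_comp)
  ultimately show "kernel_congruence loop_word \<subset> kernel_congruence loop_class"
    by blast
qed

end
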